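(* Every downset $D$ in a polyhedral partially ordered group $Q$ has a canonical primary decomposition $D=\bigcup_\tau P_\tau(D)$, the union being over all faces $\tau$ of the positive cone with nonempty support $\Gamma_\tau(D_\tau)$.
   Context: A partially ordered group is an abelian group $Q$ generated by a submonoid $Q_+$ (the positive cone) with trivial unit group, ordered by $q\preceq q'\iff q'-q\in Q_+$. A face of $Q_+$ is a submonoid $\sigma\subseteq Q_+$ such that $Q_+\smallsetminus\sigma$ is an ideal of the monoid $Q_+$. $Q$ is polyhedral if it has only finitely many faces. A downset is a subset closed under going down. For a downset $D\subseteq Q$ and a face $\tau$: the localization of $D$ along $\tau$ is $D_\tau=\{q\in D\mid q+\tau\subseteq D\}$ (again a downset). An element $q\in D$ is globally supported on $\tau$ if $q\notin D_{\tau'}$ for every face $\tau'\not\subseteq\tau$; $\Gamma_\tau D$ is the set of $q\in D$ globally supported on $\tau$. The local $\tau$-support of $D$ is $\Gamma_\tau(D_\tau)$, the set of elements globally supported on $\tau$ in the downset $D_\tau$. The $\tau$-primary component of $D$ is the downset $P_\tau(D)=\Gamma_\tau(D_\tau)-Q_+$. A downset $D$ is coprimary if $D=P_\tau(D)$ for some face $\tau$. A primary decomposition of $D$ is an expression $D=\bigcup_{i=1}^r D_i$ with each $D_i$ a coprimary downset. *)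

theory Defs
  imports "HOL-Computational_Algebra.Group_Closure"
begin

text \<open>The group is the whole type; the positive cone is an explicit set \<open>P\<close>.\<close>

definition submonoid :: "'a::ab_group_add set \<Rightarrow> bool" where
  "submonoid S \<longleftrightarrow> 0 \<in> S \<and> (\<forall>x\<in>S. \<forall>y\<in>S. x + y \<in> S)"

text \<open>The empty ideal is allowed, so that a monoid is a face of itself.\<close>

definition monoid_ideal :: "'a::ab_group_add set \<Rightarrow> 'a set \<Rightarrow> bool" where
  "monoid_ideal M I \<longleftrightarrow> I \<subseteq> M \<and> (\<forall>x\<in>I. \<forall>m\<in>M. x + m \<in> I)"

definition partially_ordered_group :: "'a::ab_group_add set \<Rightarrow> bool" where
  "partially_ordered_group P \<longleftrightarrow>
     submonoid P \<and> (\<forall>x. x \<in> P \<and> - x \<in> P \<longrightarrow> x = 0) \<and> group_closure P = UNIV"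

definition cone_le :: "'a::ab_group_add set \<Rightarrow> 'a \<Rightarrow> 'a \<Rightarrow> bool" where
  "cone_le P q q' \<longleftrightarrow> q' - q \<in> P"

definition is_face :: "'a::ab_group_add set \<Rightarrow> 'a set \<Rightarrow> bool" where
  "is_face P \<sigma> \<longleftrightarrow> \<sigma> \<subseteq> P \<and> submonoid \<sigma> \<and> monoid_ideal P (P - \<sigma>)"

definition polyhedral :: "'a::ab_group_add set \<Rightarrow> bool" where
  "polyhedral P \<longleftrightarrow> finite {\<sigma>. is_face P \<sigma>}"

definition downset :: "'a::ab_group_add set \<Rightarrow> 'a set \<Rightarrow> bool" where
  "downset P D \<longleftrightarrow> (\<forall>q\<in>D. \<forall>p. cone_le P p q \<longrightarrow> p \<in> D)"

definition localization :: "'a::ab_group_add set \<Rightarrow> 'a set \<Rightarrow> 'a set" where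
  "localization \<tau> D = {q \<in> D. \<forall>t\<in>\<tau>. q + t \<in> D}"

definition global_support :: "'a::ab_group_add set \<Rightarrow> 'a set \<Rightarrow> 'a set \<Rightarrow> 'a set" where
  "global_support P \<tau> D =
     {q \<in> D. \<forall>\<tau>'. is_face P \<tau>' \<and> \<not> \<tau>' \<subseteq> \<tau> \<longrightarrow> q \<notin> localization \<tau>' D}"

definition local_support :: "'a::ab_group_add set \<Rightarrow> 'a set \<Rightarrow> 'a set \<Rightarrow> 'a set" where
  "local_support P \<tau> D = global_support P \<tau> (localization \<tau> D)"

text \<open>\<open>P\<^sub>\<tau>(D) = \<Gamma>\<^sub>\<tau>(D\<^sub>\<tau>) - Q\<^sub>+\<close>, with elementwise (Minkowski) difference.\<close>

definition primary_component :: "'a::ab_group_add set \<Rightarrow> 'a set \<Rightarrow> 'a set \<Rightarrow> 'a set" where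
  "primary_component P \<tau> D = {g - p | g p. g \<in> local_support P \<tau> D \<and> p \<in> P}"

definition coprimary :: "'a::ab_group_add set \<Rightarrow> 'a set \<Rightarrow> bool" where
  "coprimary P D \<longleftrightarrow> downset P D \<and> (\<exists>\<tau>. is_face P \<tau> \<and> D = primary_component P \<tau> D)"

text \<open>The finite index set \<open>I\<close> replaces \<open>{1..r}\<close>; \<open>r = 0\<close> is allowed and occurs only for
  \<open>D = {}\<close>.\<close>

definition primary_decomposition ::
    "'a::ab_group_add set \<Rightarrow> 'a set \<Rightarrow> 'i set \<Rightarrow> ('i \<Rightarrow> 'a set) \<Rightarrow> bool" where
  "primary_decomposition P D I F \<longleftrightarrow>
     finite I \<and> (\<forall>i\<in>I. coprimary P (F i)) \<and> D = (\<Union>i\<in>I. F i)"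

end

theory Submission
  imports Defs
begin

text \<open>
  Given \<open>q \<in> D\<close>, choose a face \<open>\<tau>\<close> maximal among the faces with
  \<open>q + \<tau> \<subseteq> D\<close>; one exists because \<open>{0}\<close> is such a face and there are finitely many faces. Then
  \<open>q\<close> already lies in the local \<open>\<tau>\<close>-support. Otherwise \<open>q + \<tau> + \<tau>' \<subseteq> D\<close> for some face
  \<open>\<tau>' \<not>\<subseteq> \<tau>\<close>; since \<open>\<tau> + \<tau>'\<close> is cofinal in the face that it generates and \<open>D\<close> is a downset, the
  whole of that larger face can be added to \<open>q\<close> inside \<open>D\<close>, contrary to maximality
  (lemma \<open>local_support_if_maximal\<close>). So \<open>D\<close> is covered by its primary components, and each of them
  lies in \<open>D\<close> because \<open>D\<close> is a downset.

  A primary component \<open>E = P\<^sub>\<tau>(D)\<close> is coprimary because taking it twice changes nothing. The local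
  support \<open>L\<close> of \<open>D\<close> is stable under adding elements of \<open>\<tau>\<close>, so localizing \<open>E\<close> along \<open>\<tau>\<close> has
  no effect; and \<open>L \<subseteq> E \<subseteq> D\<^sub>\<tau>\<close>, so elements of \<open>L\<close>, having no room in other directions in
  \<open>D\<^sub>\<tau>\<close>, have none in \<open>E\<close> either. Thus \<open>L\<close> is contained in the local support of \<open>E\<close>, and the
  downset \<open>E\<close> generated by \<open>L\<close> is recovered (lemma \<open>primary_component_idem\<close>).
\<close>

section \<open>Submonoids and faces\<close>

lemma submonoidD:
  assumes "submonoid S"
  shows "0 \<in> S" "\<And>x y. x \<in> S \<Longrightarrow> y \<in> S \<Longrightarrow> x + y \<in> S"
  using assms by (auto simp: submonoid_def)

lemma is_faceD:
  assumes "is_face P \<tau>"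
  shows "\<tau> \<subseteq> P" "0 \<in> \<tau>" "\<And>x y. x \<in> \<tau> \<Longrightarrow> y \<in> \<tau> \<Longrightarrow> x + y \<in> \<tau>"
  using assms by (auto simp: is_face_def submonoid_def)

text \<open>The ideal condition on the complement amounts to saying that a face contains the summands in the cone of
  each of its elements.\<close>

lemma is_faceI:
  assumes "submonoid P" "\<tau> \<subseteq> P" "submonoid \<tau>"
    and "\<And>x m. x \<in> P \<Longrightarrow> m \<in> P \<Longrightarrow> x + m \<in> \<tau> \<Longrightarrow> x \<in> \<tau>"
  shows "is_face P \<tau>"
  unfolding is_face_def monoid_ideal_def
  using assms(2,3) assms(4) submonoidD(2)[OF assms(1)] by blast

lemma is_face_zero:
  assumes "submonoid P" and units: "\<And>x. x \<in> P \<Longrightarrow> - x \<in> P \<Longrightarrow> x = 0"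
  shows "is_face P {0}"
proof (rule is_faceI)
  fix x m assume x: "x \<in> P" and m: "m \<in> P" and xm: "x + m \<in> {0}"
  have "- x = m" using singletonD[OF xm] by (rule minus_unique)
  then have "- x \<in> P" using m by (rule ssubst)
  with x have "x = 0" by (rule units)
  then show "x \<in> {0}" by simp
next
  show "submonoid {0}" by (simp add: submonoid_def)
next
  show "{0} \<subseteq> P" using submonoidD(1)[OF assms(1)] by simp
qed (rule assms(1))

definition generated_face :: "'a::ab_group_add set \<Rightarrow> 'a set \<Rightarrow> 'a set" where
  "generated_face P M = {s \<in> P. \<exists>m\<in>M. m - s \<in> P}"

text \<open>For a submonoid \<open>M\<close> of the cone, the face it generates needs no further closure: it is just the part of
  the cone lying below \<open>M\<close>. This is what makes \<open>M\<close> cofinal in it.\<close>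

lemma is_face_generated_face:
  assumes P: "submonoid P" and M: "submonoid M"
  shows "is_face P (generated_face P M)"
proof (rule is_faceI[OF P])
  show "generated_face P M \<subseteq> P" by (auto simp: generated_face_def)
next
  show "submonoid (generated_face P M)"
    unfolding submonoid_def
  proof (intro conjI ballI)
    show "0 \<in> generated_face P M"
      using submonoidD(1)[OF P] submonoidD(1)[OF M]
      by (auto simp: generated_face_def intro!: bexI[of _ 0])
  next
    fix x y assume "x \<in> generated_face P M" "y \<in> generated_face P M"
    then obtain m n where mn: "x \<in> P" "y \<in> P" "m \<in> M" "n \<in> M" "m - x \<in> P" "n - y \<in> P"
      by (auto simp: generated_face_def)
    have "(m + n) - (x + y) = (m - x) + (n - y)" by simp
    with mn have "(m + n) - (x + y) \<in> P" using submonoidD(2)[OF P] by metis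
    with mn show "x + y \<in> generated_face P M"
      unfolding generated_face_def using submonoidD(2)[OF P] submonoidD(2)[OF M] by blast
  qed
next
  fix x m assume *: "x \<in> P" "m \<in> P" "x + m \<in> generated_face P M"
  then obtain n where n: "n \<in> M" "n - (x + m) \<in> P" by (auto simp: generated_face_def)
  have "n - x = (n - (x + m)) + m" by simp
  with n * have "n - x \<in> P" using submonoidD(2)[OF P] by metis
  with n * show "x \<in> generated_face P M" by (auto simp: generated_face_def)
qed

lemma submonoid_sum:
  assumes "submonoid S" "submonoid T"
  shows "submonoid {s + t | s t. s \<in> S \<and> t \<in> T}"
  unfolding submonoid_def
proof (intro conjI ballI)
  show "0 \<in> {s + t | s t. s \<in> S \<and> t \<in> T}"
    using submonoidD(1)[OF assms(1)] submonoidD(1)[OF assms(2)] add_0_left[of 0, symmetric]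
    by blast
next
  fix x y assume "x \<in> {s + t | s t. s \<in> S \<and> t \<in> T}" "y \<in> {s + t | s t. s \<in> S \<and> t \<in> T}"
  then obtain s t s' t' where *: "x = s + t" "y = s' + t'" "s \<in> S" "t \<in> T" "s' \<in> S" "t' \<in> T"
    by auto
  have "x + y = (s + s') + (t + t')" using * by (simp add: algebra_simps)
  with * show "x + y \<in> {s + t | s t. s \<in> S \<and> t \<in> T}"
    using submonoidD(2)[OF assms(1)] submonoidD(2)[OF assms(2)] by blast
qed

section \<open>Localization and support of downsets\<close>

lemma downsetD: "downset P D \<Longrightarrow> q \<in> D \<Longrightarrow> q - p \<in> P \<Longrightarrow> p \<in> D"
  by (auto simp: downset_def cone_le_def)

lemma downset_localization:
  assumes "downset P D"
  shows "downset P (localization \<tau> D)"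
  unfolding downset_def cone_le_def
proof (intro ballI allI impI)
  fix q p assume q: "q \<in> localization \<tau> D" and le: "q - p \<in> P"
  have "p \<in> D" using downsetD[OF assms _ le] q by (simp add: localization_def)
  moreover have "p + t \<in> D" if "t \<in> \<tau>" for t
    using downsetD[OF assms, of "q + t" "p + t"] q le that by (simp add: localization_def)
  ultimately show "p \<in> localization \<tau> D" by (simp add: localization_def)
qed

lemma localization_mono: "D \<subseteq> E \<Longrightarrow> localization \<tau> D \<subseteq> localization \<tau> E"
  by (auto simp: localization_def)

lemma local_support_subset: "local_support P \<tau> D \<subseteq> localization \<tau> D"
  by (auto simp: local_support_def global_support_def)

text \<open>Moving up inside a downset only shrinks the set of directions in which one can go
  arbitrarily far.\<close>

lemma global_support_up_closed:
  assumes "downset P D" "g \<in> global_support P \<tau> D" "h \<in> D" "h - g \<in> P"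
  shows "h \<in> global_support P \<tau> D"
  using assms downsetD[OF downset_localization[OF assms(1)]]
  unfolding global_support_def by blast

lemma local_support_add_face:
  assumes D: "downset P D" and \<tau>: "is_face P \<tau>"
    and g: "g \<in> local_support P \<tau> D" and t: "t \<in> \<tau>"
  shows "g + t \<in> local_support P \<tau> D"
  unfolding local_support_def
proof (rule global_support_up_closed[OF downset_localization[OF D]])
  show "g \<in> global_support P \<tau> (localization \<tau> D)"
    using g by (simp add: local_support_def)
  have "g \<in> localization \<tau> D" using g local_support_subset by blast
  then show "g + t \<in> localization \<tau> D"
    using t is_faceD(3)[OF \<tau>] by (auto simp: localization_def add.assoc)
  show "g + t - g \<in> P" using t is_faceD(1)[OF \<tau>] by auto
qed

text \<open>If \<open>q\<close> were in the localization of \<open>D\<^sub>\<tau>\<close> along some \<open>\<tau>' \<not>\<subseteq> \<tau>\<close>, the face generated by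
  \<open>\<tau> + \<tau>'\<close> would contradict the maximality of \<open>\<tau>\<close>.\<close>

lemma local_support_if_maximal:
  assumes P: "submonoid P" and D: "downset P D" and \<tau>: "is_face P \<tau>"
    and q: "q \<in> localization \<tau> D"
    and max: "\<And>\<sigma>. is_face P \<sigma> \<Longrightarrow> q \<in> localization \<sigma> D \<Longrightarrow> \<tau> \<subseteq> \<sigma> \<Longrightarrow> \<sigma> = \<tau>"
  shows "q \<in> local_support P \<tau> D"
proof -
  have "\<tau>' \<subseteq> \<tau>" if \<tau>': "is_face P \<tau>'" and q': "q \<in> localization \<tau>' (localization \<tau> D)" for \<tau>'
  proof -
    define M where "M = {t + t' | t t'. t \<in> \<tau> \<and> t' \<in> \<tau>'}"
    define \<sigma> where "\<sigma> = generated_face P M"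
    have "submonoid M" unfolding M_def
      by (rule submonoid_sum) (use \<tau> \<tau>' in \<open>auto simp: is_face_def\<close>)
    then have \<sigma>: "is_face P \<sigma>" unfolding \<sigma>_def by (rule is_face_generated_face[OF P])
    have "M \<subseteq> P"
      using is_faceD(1)[OF \<tau>] is_faceD(1)[OF \<tau>'] submonoidD(2)[OF P] by (auto simp: M_def)
    then have M_generated: "M \<subseteq> \<sigma>"
      using submonoidD(1)[OF P] by (auto simp: \<sigma>_def generated_face_def intro!: bexI)
    have "t + 0 \<in> M" if "t \<in> \<tau>" for t
      using that is_faceD(2)[OF \<tau>'] unfolding M_def by blast
    moreover have "0 + t \<in> M" if "t \<in> \<tau>'" for t
      using that is_faceD(2)[OF \<tau>] unfolding M_def by blast
    ultimately have sub: "\<tau> \<subseteq> \<sigma>" "\<tau>' \<subseteq> \<sigma>" using M_generated by auto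
    have qM: "q + m \<in> D" if m: "m \<in> M" for m
    proof -
      obtain t t' where "m = t + t'" "t \<in> \<tau>" "t' \<in> \<tau>'" using m by (auto simp: M_def)
      moreover from this have "(q + t') + t \<in> D" using q' by (simp add: localization_def)
      ultimately show ?thesis by (simp add: ac_simps)
    qed
    have "q + s \<in> D" if s: "s \<in> \<sigma>" for s
    proof -
      obtain m where m: "m \<in> M" "m - s \<in> P"
        using s by (auto simp: \<sigma>_def generated_face_def)
      then show ?thesis using downsetD[OF D qM[OF m(1)], of "q + s"] by simp
    qed
    then have "q \<in> localization \<sigma> D" using q by (auto simp: localization_def)
    with max[OF \<sigma>] sub show ?thesis by blast
  qed
  with q show ?thesis by (auto simp: local_support_def global_support_def)
qed

section \<open>Primary components\<close>

lemma downset_primary_component: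
  assumes P: "submonoid P"
  shows "downset P (primary_component P \<tau> D)"
  unfolding downset_def cone_le_def
proof (intro ballI allI impI)
  fix q p assume "q \<in> primary_component P \<tau> D" "q - p \<in> P"
  then obtain g r where *: "g \<in> local_support P \<tau> D" "r \<in> P" "q = g - r"
    by (auto simp: primary_component_def)
  have "p = g - (r + (q - p))" using * by simp
  moreover have "r + (q - p) \<in> P" using * \<open>q - p \<in> P\<close> submonoidD(2)[OF P] by blast
  ultimately show "p \<in> primary_component P \<tau> D"
    using *(1) unfolding primary_component_def by blast
qed

lemma local_support_subset_primary_component:
  assumes "submonoid P"
  shows "local_support P \<tau> D \<subseteq> primary_component P \<tau> D"
proof
  fix g assume "g \<in> local_support P \<tau> D"
  then have "g - 0 \<in> primary_component P \<tau> D"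
    using submonoidD(1)[OF assms] unfolding primary_component_def by blast
  then show "g \<in> primary_component P \<tau> D" by simp
qed

lemma primary_component_least:
  assumes "downset P E" "local_support P \<tau> D \<subseteq> E"
  shows "primary_component P \<tau> D \<subseteq> E"
proof
  fix q assume "q \<in> primary_component P \<tau> D"
  then obtain g p where "g \<in> local_support P \<tau> D" "p \<in> P" "q = g - p"
    by (auto simp: primary_component_def)
  then show "q \<in> E" using downsetD[OF assms(1), of g q] assms(2) by auto
qed

lemma localization_primary_component:
  assumes "downset P D" "is_face P \<tau>"
  shows "localization \<tau> (primary_component P \<tau> D) = primary_component P \<tau> D"
proof -
  have "q + t \<in> primary_component P \<tau> D"
    if q: "q \<in> primary_component P \<tau> D" and t: "t \<in> \<tau>" for q t
  proof -
    obtain g p where *: "g \<in> local_support P \<tau> D" "p \<in> P" "q = g - p"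
      using q by (auto simp: primary_component_def)
    have "q + t = (g + t) - p" using * by simp
    with * show ?thesis
      using local_support_add_face[OF assms *(1) t]
      unfolding primary_component_def by blast
  qed
  then show ?thesis by (auto simp: localization_def)
qed

lemma primary_component_idem:
  assumes P: "submonoid P" and D: "downset P D" and \<tau>: "is_face P \<tau>"
  shows "primary_component P \<tau> (primary_component P \<tau> D) = primary_component P \<tau> D"
    (is "primary_component P \<tau> ?E = ?E")
proof
  have loc: "localization \<tau> ?E = ?E" by (rule localization_primary_component[OF D \<tau>])
  show "primary_component P \<tau> ?E \<subseteq> ?E"
    using primary_component_least[OF downset_primary_component[OF P]] local_support_subset loc
    by blast
  have "?E \<subseteq> localization \<tau> D"
    by (rule primary_component_least[OF downset_localization[OF D] local_support_subset])
  then have "localization \<tau>' ?E \<subseteq> localization \<tau>' (localization \<tau> D)" for \<tau>'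
    by (rule localization_mono)
  then have "local_support P \<tau> D \<subseteq> local_support P \<tau> ?E"
    using local_support_subset_primary_component[OF P, of \<tau> D]
    unfolding local_support_def loc global_support_def by blast
  then show "?E \<subseteq> primary_component P \<tau> ?E"
    using primary_component_least[OF downset_primary_component[OF P]]
      local_support_subset_primary_component[OF P] by (metis order_trans)
qed

section \<open>The canonical primary decomposition\<close>

theorem corollary5p21:
  fixes Qp :: "'a::ab_group_add set" and D :: "'a set"
  assumes "partially_ordered_group Qp"
    and "polyhedral Qp"
    and "downset Qp D"
  shows "primary_decomposition Qp D
           {\<tau>. is_face Qp \<tau> \<and> local_support Qp \<tau> D \<noteq> {}}
           (\<lambda>\<tau>. primary_component Qp \<tau> D)"
proof -
  have P: "submonoid Qp" and units: "\<And>x. x \<in> Qp \<Longrightarrow> - x \<in> Qp \<Longrightarrow> x = 0"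
    using assms(1) by (auto simp: partially_ordered_group_def)
  have fin: "finite {\<tau>. is_face Qp \<tau>}" using assms(2) by (simp add: polyhedral_def)
  have coprimary: "coprimary Qp (primary_component Qp \<tau> D)" if "is_face Qp \<tau>" for \<tau>
    unfolding coprimary_def
    using that downset_primary_component[OF P] primary_component_idem[OF P assms(3) that] by metis
  have below: "primary_component Qp \<tau> D \<subseteq> D" for \<tau>
    by (rule primary_component_least[OF assms(3)])
      (use local_support_subset in \<open>force simp: localization_def\<close>)
  have cover: "\<exists>\<tau>. is_face Qp \<tau> \<and> q \<in> local_support Qp \<tau> D" if q: "q \<in> D" for q
  proof -
    let ?F = "{\<tau>. is_face Qp \<tau> \<and> q \<in> localization \<tau> D}"
    have "finite ?F" using fin by (rule finite_subset[rotated]) auto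
    moreover have "{0} \<in> ?F" using is_face_zero[OF P units] q by (simp add: localization_def)
    ultimately obtain \<tau> where \<tau>: "\<tau> \<in> ?F" and max: "\<forall>\<sigma>\<in>?F. \<tau> \<subseteq> \<sigma> \<longrightarrow> \<tau> = \<sigma>"
      using finite_has_maximal[of ?F] by auto
    have "q \<in> local_support Qp \<tau> D"
      by (rule local_support_if_maximal[OF P assms(3)]) (use \<tau> max in auto)
    with \<tau> show ?thesis by auto
  qed
  have "D = (\<Union>\<tau>\<in>{\<tau>. is_face Qp \<tau> \<and> local_support Qp \<tau> D \<noteq> {}}. primary_component Qp \<tau> D)"
    (is "D = ?U")
  proof
    show "D \<subseteq> ?U"
    proof
      fix q assume "q \<in> D"
      then obtain \<tau> where "is_face Qp \<tau>" "q \<in> local_support Qp \<tau> D" using cover by auto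
      moreover from this have "q \<in> primary_component Qp \<tau> D"
        using local_support_subset_primary_component[OF P, of \<tau> D] by auto
      ultimately show "q \<in> ?U" by auto
    qed
    show "?U \<subseteq> D" by (rule UN_least) (rule below)
  qed
  moreover have "finite {\<tau>. is_face Qp \<tau> \<and> local_support Qp \<tau> D \<noteq> {}}"
    using fin by (rule finite_subset[rotated]) auto
  ultimately show ?thesis
    unfolding primary_decomposition_def
    by (intro conjI ballI) (assumption | rule coprimary | blast)+
qed

end
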